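(* Fix $p>0$ and let $u^\star(x)$ be the $u$-component of the pointwise solution of the quadratic program $$\min_{(u,\delta)\in\mathbb{R}^{m+1}} \tfrac12\|u\|^2+\tfrac12 p\,\delta^2\quad\text{s.t.}\quad L_fV(x)+L_gV(x)u+\gamma(V(x))\le\delta,\qquad L_fh(x)+L_gh(x)u+\alpha(h(x))\ge 0 .$$ Assume that there exists a class $\mathcal{K}_\infty$ function $\gamma_1$ such that $\gamma_1(\|x\|)\le\gamma(V(x))$. Let $$\bar v:=\sup_{x\in\mathbb{R}^n\setminus\{0\}}\frac{L_fV(x)}{L_gV(x)L_gV(x)^\top}\in[-\infty,\infty].$$ If $\bar v$ is finite, then all the possible equilibrium points $x_{eq}$ of the closed-loop system $\dot x=f(x)+g(x)u^\star(x)$ in the interior of the set $\mathscr{C}$ are bounded by $$\|x_{eq}\|\le\gamma_1^{-1}(p^{-1}\bar v).$$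
   Context: Setting: $\dot x=f(x)+g(x)u$, $x\in\mathbb{R}^n$, $u\in\mathbb{R}^m$, with $f:\mathbb{R}^n\to\mathbb{R}^n$ and $g:\mathbb{R}^n\to\mathbb{R}^{n\times m}$ locally Lipschitz. For a differentiable $\phi:\mathbb{R}^n\to\mathbb{R}$, $L_f\phi=\nabla\phi^\top f\in\mathbb{R}$ and $L_g\phi=\nabla\phi^\top g\in\mathbb{R}^{1\times m}$. $V:\mathbb{R}^n\to\mathbb{R}$ is a control Lyapunov function (CLF): $V$ is smooth and positive definite, and $\inf_{u\in\mathbb{R}^m}[L_fV(x)+L_gV(x)u]\le-\gamma(V(x))$ for all $x\in\mathbb{R}^n$, where $\gamma:\mathbb{R}_{\ge0}\to\mathbb{R}_{\ge0}$ is class $\mathcal{K}$ (continuous, strictly increasing, $\gamma(0)=0$). A class $\mathcal{K}_\infty$ function is a class $\mathcal{K}$ function on $[0,\infty)$ that tends to $\infty$ at $\infty$. $h:\mathbb{R}^n\to\mathbb{R}$ is a control barrier function (CBF): $h$ is smooth and $\sup_{u\in\mathbb{R}^m}[L_fh(x)+L_gh(x)u+\alpha(h(x))]\ge0$ for all $x\in\mathbb{R}^n$, where $\alpha:\mathbb{R}\to\mathbb{R}$ is a locally Lipschitz extended class $\mathcal{K}$ function (continuous, strictly increasing, $\alpha(0)=0$). The safety set is $\mathscr{C}=\{x\in\mathbb{R}^n: h(x)\ge0\}$. The origin is in the interior of $\mathscr{C}$. These functions $\gamma,\alpha$ are the ones used in the quadratic program. An equilibrium point is a point $x$ with $f(x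)+g(x)u^\star(x)=0$.
   Formalization: When v̄ is finite but negative, γ₁⁻¹(p⁻¹v̄) is undefined (e.g. f=−x, g=1, V=x², γ(s)=s, h≡1: v̄=−1/2, the origin being an equilibrium); there the bound is read as 0, so only the origin can be an equilibrium. *)

theory Defs
  imports "HOL-Analysis.Analysis"
begin

definition locally_lipschitz :: "('a::metric_space \<Rightarrow> 'b::metric_space) \<Rightarrow> bool" where
  "locally_lipschitz F \<longleftrightarrow> local_lipschitz (UNIV :: real set) UNIV (\<lambda>t. F)"

definition grad :: "(real ^ 'n \<Rightarrow> real) \<Rightarrow> real ^ 'n \<Rightarrow> real ^ 'n" where
  "grad \<phi> x = (THE D. GDERIV \<phi> x :> D)"

primrec C_class :: "nat \<Rightarrow> (real ^ 'n \<Rightarrow> real) \<Rightarrow> bool" where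
  "C_class 0 \<phi> \<longleftrightarrow> continuous_on UNIV \<phi>"
| "C_class (Suc k) \<phi> \<longleftrightarrow>
     (\<forall>x. \<phi> differentiable (at x)) \<and> (\<forall>i. C_class k (\<lambda>x. grad \<phi> x $ i))"

definition smooth :: "(real ^ 'n \<Rightarrow> real) \<Rightarrow> bool" where
  "smooth \<phi> \<longleftrightarrow> (\<forall>k. C_class k \<phi>)"

definition lie_f :: "(real ^ 'n \<Rightarrow> real ^ 'n) \<Rightarrow> (real ^ 'n \<Rightarrow> real) \<Rightarrow> real ^ 'n \<Rightarrow> real" where
  "lie_f f \<phi> x = grad \<phi> x \<bullet> f x"

text \<open>The row vector of Lie derivatives along the columns of \<open>g\<close>; its product with a column
  vector \<open>u\<close> is the inner product with \<open>u\<close>.\<close>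

definition lie_g ::
    "(real ^ 'n \<Rightarrow> real ^ 'm ^ 'n) \<Rightarrow> (real ^ 'n \<Rightarrow> real) \<Rightarrow> real ^ 'n \<Rightarrow> real ^ 'm" where
  "lie_g g \<phi> x = grad \<phi> x v* g x"

text \<open>Functions of class K live on the half-line \<open>{0..}\<close>; they are represented by total functions
  whose values at negative arguments are irrelevant. Nonnegativity on \<open>{0..}\<close> follows from
  monotonicity.\<close>

definition class_K :: "(real \<Rightarrow> real) \<Rightarrow> bool" where
  "class_K \<gamma> \<longleftrightarrow> continuous_on {0..} \<gamma> \<and> strict_mono_on {0..} \<gamma> \<and> \<gamma> 0 = 0"

definition class_K_inf :: "(real \<Rightarrow> real) \<Rightarrow> bool" where
  "class_K_inf \<gamma> \<longleftrightarrow> class_K \<gamma> \<and> filterlim \<gamma> at_top at_top"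

definition extended_class_K :: "(real \<Rightarrow> real) \<Rightarrow> bool" where
  "extended_class_K \<alpha> \<longleftrightarrow> continuous_on UNIV \<alpha> \<and> strict_mono \<alpha> \<and> \<alpha> 0 = 0"

text \<open>The inverse of a function of class K-infinity, as a map from \<open>{0..}\<close> to \<open>{0..}\<close>. A negative
  number is below the range of such a function and is sent to \<open>0\<close>.\<close>

definition K_inf_inverse :: "(real \<Rightarrow> real) \<Rightarrow> real \<Rightarrow> real" where
  "K_inf_inverse \<gamma> s = (if s < 0 then 0 else the_inv_into {0..} \<gamma> s)"

definition positive_definite :: "(real ^ 'n \<Rightarrow> real) \<Rightarrow> bool" where
  "positive_definite V \<longleftrightarrow> V 0 = 0 \<and> (\<forall>x. x \<noteq> 0 \<longrightarrow> V x > 0)"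

text \<open>Infima and suprema over \<open>u\<close> are taken in the extended reals, as they may be infinite.\<close>

definition control_lyapunov_function ::
    "(real ^ 'n \<Rightarrow> real ^ 'n) \<Rightarrow> (real ^ 'n \<Rightarrow> real ^ 'm ^ 'n) \<Rightarrow> (real \<Rightarrow> real)
      \<Rightarrow> (real ^ 'n \<Rightarrow> real) \<Rightarrow> bool" where
  "control_lyapunov_function f g \<gamma> V \<longleftrightarrow>
     smooth V \<and> positive_definite V \<and>
     (\<forall>x. (INF u. ereal (lie_f f V x + lie_g g V x \<bullet> u)) \<le> ereal (- \<gamma> (V x)))"

definition control_barrier_function ::
    "(real ^ 'n \<Rightarrow> real ^ 'n) \<Rightarrow> (real ^ 'n \<Rightarrow> real ^ 'm ^ 'n) \<Rightarrow> (real \<Rightarrow> real)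
      \<Rightarrow> (real ^ 'n \<Rightarrow> real) \<Rightarrow> bool" where
  "control_barrier_function f g \<alpha> h \<longleftrightarrow>
     smooth h \<and>
     (\<forall>x. (SUP u. ereal (lie_f f h x + lie_g g h x \<bullet> u + \<alpha> (h x))) \<ge> 0)"

definition safe_set :: "(real ^ 'n \<Rightarrow> real) \<Rightarrow> (real ^ 'n) set" where
  "safe_set h = {x. h x \<ge> 0}"

definition qp_cost :: "real \<Rightarrow> (real ^ 'm) \<times> real \<Rightarrow> real" where
  "qp_cost p = (\<lambda>(u, \<delta>). 1 / 2 * (norm u)\<^sup>2 + 1 / 2 * p * \<delta>\<^sup>2)"

definition qp_feasible ::
    "(real ^ 'n \<Rightarrow> real ^ 'n) \<Rightarrow> (real ^ 'n \<Rightarrow> real ^ 'm ^ 'n) \<Rightarrow> (real \<Rightarrow> real) \<Rightarrow> (real \<Rightarrow> real)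
      \<Rightarrow> (real ^ 'n \<Rightarrow> real) \<Rightarrow> (real ^ 'n \<Rightarrow> real) \<Rightarrow> real ^ 'n \<Rightarrow> (real ^ 'm) \<times> real \<Rightarrow> bool" where
  "qp_feasible f g \<gamma> \<alpha> V h x = (\<lambda>(u, \<delta>).
     lie_f f V x + lie_g g V x \<bullet> u + \<gamma> (V x) \<le> \<delta> \<and>
     lie_f f h x + lie_g g h x \<bullet> u + \<alpha> (h x) \<ge> 0)"

text \<open>If \<open>h\<close> is a control barrier function, the program is feasible at every \<open>x\<close>; for \<open>p > 0\<close> its
  cost is strictly convex and coercive, so \<^const>\<open>arg_min\<close> denotes the unique minimiser.\<close>

definition u_star ::
    "(real ^ 'n \<Rightarrow> real ^ 'n) \<Rightarrow> (real ^ 'n \<Rightarrow> real ^ 'm ^ 'n) \<Rightarrow> (real \<Rightarrow> real) \<Rightarrow> (real \<Rightarrow> real)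
      \<Rightarrow> (real ^ 'n \<Rightarrow> real) \<Rightarrow> (real ^ 'n \<Rightarrow> real) \<Rightarrow> real \<Rightarrow> real ^ 'n \<Rightarrow> real ^ 'm" where
  "u_star f g \<gamma> \<alpha> V h p x = fst (arg_min (qp_cost p) (qp_feasible f g \<gamma> \<alpha> V h x))"

definition equilibrium_point ::
    "(real ^ 'n \<Rightarrow> real ^ 'n) \<Rightarrow> (real ^ 'n \<Rightarrow> real ^ 'm ^ 'n) \<Rightarrow> (real ^ 'n \<Rightarrow> real ^ 'm)
      \<Rightarrow> real ^ 'n \<Rightarrow> bool" where
  "equilibrium_point f g k x \<longleftrightarrow> f x + g x *v k x = 0"

text \<open>Division is that of the extended reals. For a control Lyapunov function, a vanishing
  denominator at \<open>x \<noteq> 0\<close> forces a negative numerator, and the quotient is \<open>-\<infinity>\<close> there.\<close>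

definition v_bar ::
    "(real ^ 'n \<Rightarrow> real ^ 'n) \<Rightarrow> (real ^ 'n \<Rightarrow> real ^ 'm ^ 'n) \<Rightarrow> (real ^ 'n \<Rightarrow> real) \<Rightarrow> ereal" where
  "v_bar f g V = (SUP x \<in> UNIV - {0}. ereal (lie_f f V x) / ereal (lie_g g V x \<bullet> lie_g g V x))"

end

theory Submission
  imports Defs
begin

text \<open>At an equilibrium \<open>x\<close> the closed-loop derivatives of \<open>V\<close> and \<open>h\<close> vanish. Hence the barrier
  constraint reads \<open>\<alpha> (h x) \<ge> 0\<close> there: it is slack if \<open>h x > 0\<close>, and at an interior point with
  \<open>h x = 0\<close> it is void, because \<open>h\<close> has a local minimum and its gradient vanishes. So only the
  Lyapunov constraint is active, and the first-order condition gives
  \<open>u = - p \<gamma> (V x) L\<^sub>gV\<close>. Substituting this into \<open>L\<^sub>fV + L\<^sub>gV u = 0\<close> shows that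
  \<open>p \<gamma> (V x)\<close> is the quotient defining \<open>v\<close>-bar at \<open>x\<close>.\<close>

section \<open>Gradients of differentiable functions\<close>

text \<open>\<open>grad\<close> is a definite description, so it carries information only once a
  representing vector is shown to exist and be unique; expanding the derivative in the standard
  basis supplies the vector \<open>e\<close>.\<close>

lemma has_derivative_grad:
  fixes \<phi> :: "real ^ 'n \<Rightarrow> real"
  assumes "\<phi> differentiable (at x)"
  shows "(\<phi> has_derivative (\<lambda>v. v \<bullet> grad \<phi> x)) (at x)"
proof -
  from assms obtain D where D: "(\<phi> has_derivative D) (at x)"
    by (auto simp: differentiable_def)
  define e where "e = (\<Sum>b\<in>Basis. D b *\<^sub>R b)"
  have D_eq: "D = (\<lambda>v. v \<bullet> e)"
  proof
    fix v
    have "linear D"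
      using D by (rule has_derivative_linear)
    have "D v = D (\<Sum>b\<in>Basis. (v \<bullet> b) *\<^sub>R b)"
      by (simp only: euclidean_representation)
    also have "\<dots> = v \<bullet> e"
      by (simp only: e_def linear_sum[OF \<open>linear D\<close>] linear_scale[OF \<open>linear D\<close>]
          inner_sum_right inner_scaleR_right real_scaleR_def mult.commute)
    finally show "D v = v \<bullet> e" .
  qed
  have e: "GDERIV \<phi> x :> e"
    using D unfolding gderiv_def D_eq .
  moreover have "A = e" if "GDERIV \<phi> x :> A" for A
  proof -
    have "(\<lambda>v. v \<bullet> A) = (\<lambda>v. v \<bullet> e)"
      using that e by (auto simp: gderiv_def intro: has_derivative_unique)
    then have "\<forall>v. v \<bullet> A = v \<bullet> e"
      by (simp add: fun_eq_iff)
    then show ?thesis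
      by (simp only: vector_eq_ldot)
  qed
  ultimately have "GDERIV \<phi> x :> grad \<phi> x"
    unfolding grad_def by (rule theI)
  then show ?thesis
    by (simp add: gderiv_def)
qed

lemma smooth_imp_differentiable: "smooth \<phi> \<Longrightarrow> \<phi> differentiable (at x)"
  unfolding smooth_def by (drule spec[of _ 1]) simp

lemma grad_eq_0_of_interior_safe_set:
  assumes "\<phi> differentiable (at x)" and "x \<in> interior (safe_set \<phi>)" and "\<phi> x = 0"
  shows "grad \<phi> x = 0"
proof -
  have "(\<lambda>v. v \<bullet> grad \<phi> x) = (\<lambda>v. 0)"
  proof (rule differential_zero_maxmin)
    show "x \<in> interior (safe_set \<phi>)" "open (interior (safe_set \<phi>))"
      using assms by auto
    show "(\<phi> has_derivative (\<lambda>v. v \<bullet> grad \<phi> x)) (at x)"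
      using assms(1) by (rule has_derivative_grad)
    show "(\<forall>y\<in>interior (safe_set \<phi>). \<phi> y \<le> \<phi> x) \<or> (\<forall>y\<in>interior (safe_set \<phi>). \<phi> x \<le> \<phi> y)"
      using assms(3) interior_subset[of "safe_set \<phi>"] by (auto simp: safe_set_def)
  qed
  from fun_cong[OF this, of "grad \<phi> x"] show ?thesis
    by simp
qed

section \<open>Lie derivatives and the quadratic program\<close>

lemma lie_sum_eq_grad_inner: "lie_f f \<phi> x + lie_g g \<phi> x \<bullet> u = grad \<phi> x \<bullet> (f x + g x *v u)"
  by (simp add: lie_f_def lie_g_def dot_lmul_matrix inner_add_right)

text \<open>A supremum need not be attained, but this one is over an affine function of
  \<open>u\<close>: it is either constant, or takes every real value along
  \<open>lie_g g h x\<close>.\<close>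

lemma control_barrier_function_feasible:
  assumes "control_barrier_function f g \<alpha> h"
  shows "\<exists>u. lie_f f h x + lie_g g h x \<bullet> u + \<alpha> (h x) \<ge> 0"
proof (cases "lie_g g h x = 0")
  case True
  have "ereal 0 \<le> (SUP u. ereal (lie_f f h x + lie_g g h x \<bullet> u + \<alpha> (h x)))"
    using assms by (simp add: control_barrier_function_def zero_ereal_def)
  with True show ?thesis
    by simp
next
  case False
  let ?b = "lie_g g h x" and ?c = "lie_f f h x + \<alpha> (h x)"
  have "lie_f f h x + ?b \<bullet> ((- ?c / (?b \<bullet> ?b)) *\<^sub>R ?b) + \<alpha> (h x) = 0"
    using False by simp
  then show ?thesis
    by (metis order_refl)
qed

lemma control_lyapunov_function_lie_f_le:
  assumes "control_lyapunov_function f g \<gamma> V" and "lie_g g V x = 0"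
  shows "lie_f f V x \<le> - \<gamma> (V x)"
proof -
  have "(INF u. ereal (lie_f f V x + lie_g g V x \<bullet> u)) \<le> ereal (- \<gamma> (V x))"
    using assms(1) by (simp add: control_lyapunov_function_def)
  then show ?thesis
    using assms(2) by simp
qed

text \<open>In the coordinates \<open>(u, sqrt p * \<delta>)\<close> the cost is half the squared distance to the origin.\<close>

lemma qp_minimiser_exists:
  fixes g :: "real ^ 'n \<Rightarrow> real ^ 'm ^ 'n"
  assumes "p > 0" and "\<exists>u. lie_f f h x + lie_g g h x \<bullet> u + \<alpha> (h x) \<ge> 0"
  shows "is_arg_min (qp_cost p) (qp_feasible f g \<gamma> \<alpha> V h x)
    (arg_min (qp_cost p) (qp_feasible f g \<gamma> \<alpha> V h x))"
proof -
  let ?P = "qp_feasible f g \<gamma> \<alpha> V h x"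
  define T where "T z = (fst z, snd z / sqrt p)" for z :: "(real ^ 'm) \<times> real"
  define S where "S = {z. ?P (T z)}"
  have "closed S"
    unfolding S_def T_def qp_feasible_def split_beta fst_conv snd_conv
    using assms(1) by (intro closed_Collect_conj closed_Collect_le continuous_intros) auto
  moreover from assms(2) obtain u where "lie_f f h x + lie_g g h x \<bullet> u + \<alpha> (h x) \<ge> 0" ..
  \<comment> \<open>Here \<delta> makes the Lyapunov constraint an equality; the factor
    \<open>sqrt p\<close> undoes the scaling in \<open>T\<close>.\<close>
  then have "(u, (lie_f f V x + lie_g g V x \<bullet> u + \<gamma> (V x)) * sqrt p) \<in> S"
    using assms(1) by (simp add: S_def T_def qp_feasible_def)
  then have "S \<noteq> {}"
    by blast
  ultimately obtain z where z: "z \<in> S" "\<And>y. y \<in> S \<Longrightarrow> dist 0 z \<le> dist 0 y"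
    using distance_attains_inf by metis
  have cost: "qp_cost p (T y) = (norm y)\<^sup>2 / 2" for y
    using assms(1) by (cases y) (simp add: qp_cost_def T_def norm_Pair power_divide add_divide_distrib)
  have "qp_cost p (T z) \<le> qp_cost p w" if "?P w" for w
  proof -
    have w: "T (fst w, snd w * sqrt p) = w"
      using assms(1) by (simp add: T_def)
    with that have "(fst w, snd w * sqrt p) \<in> S"
      by (simp add: S_def)
    with z(2) have "norm z \<le> norm (fst w, snd w * sqrt p)"
      by fastforce
    then have "(norm z)\<^sup>2 \<le> (norm (fst w, snd w * sqrt p))\<^sup>2"
      by (intro power_mono) auto
    then show ?thesis
      using cost[of z] cost[of "(fst w, snd w * sqrt p)"] unfolding w by linarith
  qed
  with z(1) have "is_arg_min (qp_cost p) ?P (T z)"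
    by (auto simp: is_arg_min_linorder S_def)
  then show ?thesis
    unfolding arg_min_def by (rule someI)
qed

text \<open>Letting \<open>t\<close> tend to 0 from the right turns a comparison at step size
  \<open>t\<close> into a first-order condition.\<close>

lemma le_small_multiples_imp_nonpos:
  fixes c e K :: real
  assumes "e > 0" and "\<And>t. 0 < t \<Longrightarrow> t < e \<Longrightarrow> c \<le> t * K"
  shows "c \<le> 0"
proof (rule tendsto_lowerbound)
  show "((\<lambda>t. t * K) \<longlongrightarrow> 0) (at_right 0)"
    by (auto intro!: tendsto_eq_intros)
  show "\<forall>\<^sub>F t in at_right 0. c \<le> t * K"
    using assms by (auto simp: eventually_at_right_field)
qed auto

text \<open>First-order optimality: the slack \<open>\<delta>\<close> is at least \<open>c\<close> at the minimiser, and the competitor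
  moves \<open>u\<close> towards \<open>- p c L\<^sub>gV\<close> while keeping the Lyapunov constraint an equality.\<close>

lemma qp_minimiser_inactive_barrier:
  assumes min: "is_arg_min (qp_cost p) (qp_feasible f g \<gamma> \<alpha> V h x) (u, \<delta>)"
    and "p > 0" and c: "c = lie_f f V x + lie_g g V x \<bullet> u + \<gamma> (V x)" and "c \<ge> 0"
    and inactive: "lie_f f h x + lie_g g h x \<bullet> u + \<alpha> (h x) > 0 \<or> lie_g g h x = 0"
  shows "u = - (p * c) *\<^sub>R lie_g g V x"
proof -
  let ?a = "lie_g g V x" and ?b = "lie_g g h x"
  let ?r = "lie_f f h x + ?b \<bullet> u + \<alpha> (h x)"
  \<comment> \<open>Eliminating \<delta> through equality in the Lyapunov constraint leaves a cost
    in \<open>u\<close> alone; \<open>w\<close> is its negative gradient, and the claim is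
    \<open>w = 0\<close>.\<close>
  define w where "w = - (u + (p * c) *\<^sub>R ?a)"
  have feas: "c \<le> \<delta>" "?r \<ge> 0"
    using min by (auto simp: is_arg_min_linorder qp_feasible_def c)
  \<comment> \<open>A short step along \<open>w\<close> respects the barrier: its left-hand side is
    constant in \<open>u\<close> if \<open>?b = 0\<close>, and otherwise stays positive by
    continuity.\<close>
  obtain e where e: "e > 0" "\<And>t. 0 < t \<Longrightarrow> t < e \<Longrightarrow> ?r + t * (?b \<bullet> w) \<ge> 0"
  proof (cases "?b = 0")
    case True
    with feas(2) that[of 1] show ?thesis
      by simp
  next
    case False
    have "((\<lambda>t. ?r + t * (?b \<bullet> w)) \<longlongrightarrow> ?r) (at_right 0)"
      by (auto intro!: tendsto_eq_intros)
    with inactive False have "\<forall>\<^sub>F t in at_right 0. ?r + t * (?b \<bullet> w) > 0"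
      by (auto dest: order_tendstoD)
    with that show ?thesis
      by (force simp: eventually_at_right_field)
  qed
  have "w \<bullet> w \<le> t * ((w \<bullet> w + p * (?a \<bullet> w)\<^sup>2) / 2)" if t: "0 < t" "t < e" for t
  proof -
    have "qp_feasible f g \<gamma> \<alpha> V h x (u + t *\<^sub>R w, c + t * (?a \<bullet> w))"
      using e(2)[OF t] by (simp add: qp_feasible_def c inner_add_right algebra_simps)
    with min have "qp_cost p (u, \<delta>) \<le> qp_cost p (u + t *\<^sub>R w, c + t * (?a \<bullet> w))"
      by (simp add: is_arg_min_linorder)
    \<comment> \<open>Since 0 \<le> \<open>c\<close> \<le> \<delta>, lowering \<delta> to
      \<open>c\<close> does not raise the cost, so the comparison may start from
      \<open>(u, c)\<close>.\<close>
    moreover have "p * c\<^sup>2 \<le> p * \<delta>\<^sup>2"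
      using feas(1) \<open>p > 0\<close> \<open>c \<ge> 0\<close> by (intro mult_left_mono power_mono) auto
    ultimately have "u \<bullet> u + p * c\<^sup>2 \<le>
        (u + t *\<^sub>R w) \<bullet> (u + t *\<^sub>R w) + p * (c + t * (?a \<bullet> w))\<^sup>2"
      by (simp add: qp_cost_def power2_norm_eq_inner)
    also have "\<dots> = u \<bullet> u + p * c\<^sup>2 + t * (2 * ((u + (p * c) *\<^sub>R ?a) \<bullet> w))
        + t * (t * (w \<bullet> w + p * (?a \<bullet> w)\<^sup>2))"
      by (simp add: inner_add_left inner_add_right inner_commute power2_eq_square algebra_simps)
    also have "u + (p * c) *\<^sub>R ?a = - w"
      by (simp add: w_def)
    \<comment> \<open>The linear term of the cost along \<open>w\<close> is
      \<open>- 2 * t * (w \<bullet> w)\<close>; dividing by \<open>t\<close> leaves a bound of order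
      \<open>t\<close> on \<open>w \<bullet> w\<close>.\<close>
    finally have "0 \<le> t * (t * (w \<bullet> w + p * (?a \<bullet> w)\<^sup>2) - 2 * (w \<bullet> w))"
      by (simp add: algebra_simps)
    with t(1) show ?thesis
      by (simp add: zero_le_mult_iff)
  qed
  with e(1) have "w \<bullet> w \<le> 0"
    by (rule le_small_multiples_imp_nonpos)
  then have "w = 0"
    by (metis inner_eq_zero_iff inner_ge_zero order_antisym)
  then show ?thesis
    by (metis w_def add_eq_0_iff2 neg_equal_0_iff_equal scaleR_minus_left)
qed

section \<open>Inverses of class K-infinity functions\<close>

text \<open>Unboundedness and the intermediate value theorem put \<open>s\<close> in the range;
  strict monotonicity gives injectivity.\<close>

lemma K_inf_inverse_right:
  assumes "class_K_inf \<gamma>" and "s \<ge> 0"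
  shows "K_inf_inverse \<gamma> s \<ge> 0" and "\<gamma> (K_inf_inverse \<gamma> s) = s"
proof -
  have cont: "continuous_on {0..} \<gamma>" and mono: "strict_mono_on {0..} \<gamma>" and "\<gamma> 0 = 0"
    using assms by (auto simp: class_K_inf_def class_K_def)
  have "\<forall>\<^sub>F M in at_top. \<gamma> M \<ge> s \<and> M \<ge> 0"
    using assms(1) eventually_ge_at_top[of 0]
    by (auto simp: class_K_inf_def filterlim_at_top intro: eventually_conj)
  then obtain M where "\<gamma> M \<ge> s" "M \<ge> 0"
    using eventually_happens'[OF trivial_limit_at_top_linorder] by blast
  then obtain y where "0 \<le> y" "\<gamma> y = s"
    using IVT'[of \<gamma> 0 s M] continuous_on_subset[OF cont] \<open>\<gamma> 0 = 0\<close> assms(2) by force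
  then have s: "s \<in> \<gamma> ` {0..}"
    by auto
  have inj: "inj_on \<gamma> {0..}"
    using mono by (rule strict_mono_on_imp_inj_on)
  show "K_inf_inverse \<gamma> s \<ge> 0"
    using the_inv_into_into[OF inj s order_refl] assms(2) by (simp add: K_inf_inverse_def)
  show "\<gamma> (K_inf_inverse \<gamma> s) = s"
    using f_the_inv_into_f[OF inj s] assms(2) by (simp add: K_inf_inverse_def)
qed

lemma K_inf_inverse_nonneg: "class_K_inf \<gamma> \<Longrightarrow> K_inf_inverse \<gamma> s \<ge> 0"
  by (cases "s < 0") (auto simp: K_inf_inverse_right(1), simp add: K_inf_inverse_def)

lemma class_K_nonneg: "class_K \<gamma> \<Longrightarrow> r \<ge> 0 \<Longrightarrow> \<gamma> r \<ge> 0"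
  unfolding class_K_def
  by (metis atLeast_iff order_refl strict_mono_on_leD)

lemma le_K_inf_inverse:
  assumes "class_K_inf \<gamma>" and "r \<ge> 0" and "\<gamma> r \<le> s"
  shows "r \<le> K_inf_inverse \<gamma> s"
proof (rule ccontr)
  assume less: "\<not> r \<le> K_inf_inverse \<gamma> s"
  have K: "class_K \<gamma>"
    using assms(1) by (simp add: class_K_inf_def)
  \<comment> \<open>As 0 \<le> \<open>\<gamma> r\<close> \<le> \<open>s\<close>, the default value
    of \<open>K_inf_inverse\<close> at negative arguments does not occur.\<close>
  then have "s \<ge> 0"
    using assms class_K_nonneg by force
  note inv = K_inf_inverse_right[OF assms(1) this]
  have "\<gamma> (K_inf_inverse \<gamma> s) < \<gamma> r"
    using K inv(1) less assms(2)
    by (auto simp: class_K_def intro: strict_mono_onD)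
  with inv(2) assms(3) show False
    by simp
qed

section \<open>Equilibria of the closed loop\<close>

lemma equilibrium_lie_f_eq:
  assumes clf: "control_lyapunov_function f g \<gamma> V" and "class_K \<gamma>"
    and "extended_class_K \<alpha>" and cbf: "control_barrier_function f g \<alpha> h" and "p > 0"
    and x: "x \<in> interior (safe_set h)"
    and eq: "equilibrium_point f g (u_star f g \<gamma> \<alpha> V h p) x"
  shows "lie_f f V x = p * \<gamma> (V x) * (lie_g g V x \<bullet> lie_g g V x)"
proof -
  let ?m = "arg_min (qp_cost p) (qp_feasible f g \<gamma> \<alpha> V h x)"
  define u where "u = fst ?m"
  have "is_arg_min (qp_cost p) (qp_feasible f g \<gamma> \<alpha> V h x) (u, snd ?m)"
    using qp_minimiser_exists[where h = h and x = x and f = f and g = g and \<alpha> = \<alpha>,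
        OF \<open>p > 0\<close> control_barrier_function_feasible[OF cbf]]
    by (simp add: u_def)
  \<comment> \<open>Taken for both \<open>V\<close> and \<open>h\<close>, this reduces the
    constraint values at the minimiser to \<open>\<gamma> (V x)\<close> and
    \<open>\<alpha> (h x)\<close>.\<close>
  moreover have rest: "lie_f f \<phi> x + lie_g g \<phi> x \<bullet> u = 0" for \<phi>
    using eq by (simp add: lie_sum_eq_grad_inner equilibrium_point_def u_star_def u_def)
  have "V x \<ge> 0"
    using clf unfolding control_lyapunov_function_def positive_definite_def
    by (metis less_imp_le order_refl)
  then have "\<gamma> (V x) \<ge> 0"
    using \<open>class_K \<gamma>\<close> by (rule class_K_nonneg[rotated])
  moreover have "lie_f f h x + lie_g g h x \<bullet> u + \<alpha> (h x) > 0 \<or> lie_g g h x = 0"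
  proof (cases "h x = 0")
    case True
    then have "grad h x = 0"
      using cbf x grad_eq_0_of_interior_safe_set smooth_imp_differentiable
      unfolding control_barrier_function_def by blast
    then show ?thesis
      by (simp add: lie_g_def)
  next
    case False
    with x have "h x > 0"
      using interior_subset[of "safe_set h"] by (force simp: safe_set_def)
    then have "\<alpha> (h x) > 0"
      using \<open>extended_class_K \<alpha>\<close> unfolding extended_class_K_def by (metis strict_monoD)
    then show ?thesis
      by (simp add: rest)
  qed
  ultimately have "u = - (p * \<gamma> (V x)) *\<^sub>R lie_g g V x"
    using \<open>p > 0\<close> by (intro qp_minimiser_inactive_barrier) (auto simp: rest)
  with rest[of V] show ?thesis
    by simp
qed

theorem proposition2:
  fixes f :: "real ^ 'n \<Rightarrow> real ^ 'n"
    and g :: "real ^ 'n \<Rightarrow> real ^ 'm ^ 'n"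
    and V h :: "real ^ 'n \<Rightarrow> real"
    and \<gamma> \<gamma>\<^sub>1 \<alpha> :: "real \<Rightarrow> real"
    and p :: real
  assumes "locally_lipschitz f" and "locally_lipschitz g"
    and "class_K \<gamma>" and "control_lyapunov_function f g \<gamma> V"
    and "extended_class_K \<alpha>" and "locally_lipschitz \<alpha>"
    and "control_barrier_function f g \<alpha> h"
    and "0 \<in> interior (safe_set h)"
    and "p > 0"
    and "class_K_inf \<gamma>\<^sub>1" and "\<forall>x. \<gamma>\<^sub>1 (norm x) \<le> \<gamma> (V x)"
    and "\<bar>v_bar f g V\<bar> \<noteq> \<infinity>"
  shows "\<forall>x\<^sub>e\<^sub>q \<in> interior (safe_set h).
    equilibrium_point f g (u_star f g \<gamma> \<alpha> V h p) x\<^sub>e\<^sub>q \<longrightarrow>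
      norm x\<^sub>e\<^sub>q \<le> K_inf_inverse \<gamma>\<^sub>1 (inverse p * real_of_ereal (v_bar f g V))"
proof (intro ballI impI)
  fix x
  assume x: "x \<in> interior (safe_set h)"
    and eq: "equilibrium_point f g (u_star f g \<gamma> \<alpha> V h p) x"
  let ?a = "lie_g g V x \<bullet> lie_g g V x" and ?v = "real_of_ereal (v_bar f g V)"
  show "norm x \<le> K_inf_inverse \<gamma>\<^sub>1 (inverse p * ?v)"
  proof (cases "x = 0")
    \<comment> \<open>The supremum in \<open>v_bar\<close> omits the origin and may be negative; the
      inverse is then 0 by convention, which still bounds the norm of 0.\<close>
    case True
    then show ?thesis
      using assms(10) by (simp add: K_inf_inverse_nonneg)
  next
    case False
    have lf: "lie_f f V x = p * \<gamma> (V x) * ?a"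
      using equilibrium_lie_f_eq assms(3,4,5,7,9) x eq by blast
    have "V x > 0"
      using assms(4) False by (simp add: control_lyapunov_function_def positive_definite_def)
    then have "\<gamma> (V x) > 0"
      using assms(3) unfolding class_K_def
      by (metis atLeast_iff less_imp_le order_refl strict_mono_onD)
    \<comment> \<open>If \<open>lie_g g V x\<close> vanished, \<open>lf\<close> would give
      \<open>lie_f f V x = 0\<close>, whereas the Lyapunov condition makes it at most
      \<open>- \<gamma> (V x)\<close>, which is negative.\<close>
    then have "lie_g g V x \<noteq> 0"
      using control_lyapunov_function_lie_f_le[OF assms(4), of x] lf by force
    then have "?a \<noteq> 0"
      by simp
    have "ereal (p * \<gamma> (V x)) = ereal (lie_f f V x) / ereal ?a"
      using \<open>?a \<noteq> 0\<close> lf by simp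
    also have "\<dots> \<le> v_bar f g V"
      unfolding v_bar_def using False by (intro SUP_upper) auto
    \<comment> \<open>Finiteness of \<open>v_bar\<close> lets the bound pass from extended reals to
      \<open>?v\<close>.\<close>
    finally have "p * \<gamma> (V x) \<le> ?v"
      using assms(12) by (metis ereal_less_eq(3) ereal_real')
    then have "\<gamma> (V x) \<le> inverse p * ?v"
      using assms(9) by (simp add: field_simps)
    with assms(11) have "\<gamma>\<^sub>1 (norm x) \<le> inverse p * ?v"
      using order_trans by blast
    with assms(10) show ?thesis
      by (intro le_K_inf_inverse) auto
  qed
qed

end
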